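(* Let $\Omega\subset\mathbb{R}^d$, $d\geq 2$, be a bounded domain, with boundary split into two disjoint portions $\partial\Omega=\Gamma_1\cup\Gamma_2$ (either may be empty). Consider the second-order elliptic equation with mixed boundary conditions $\mathcal{L}u=f$ in $\Omega$, $\mathcal{B}u=g$ on $\partial\Omega$, where $$\mathcal{L}u(P)=\sum_{i,j=1}^d c_{ij}(P)\,\partial^2_{x_ix_j}u(P)+\langle\nabla u(P),\vec b(P)\rangle+\rho(P)u(P),\quad P\in\Omega,$$ $$\mathcal{B}u(P)=\chi_{\Gamma_1}(P)\,u(P)+\chi_{\Gamma_2}(P)\,\partial_\nu u(P),\quad P\in\partial\Omega,$$ and $\mathcal{L}$ is elliptic in the sense that $\sum_{i,j}c_{ij}(P)\xi_i\xi_j\neq 0$ for all $P\in\Omega$ and all $\xi\in\mathbb{R}^d\setminus\{0\}$. Let $\phi$ be a polyharmonic spline radial function, that is, either $\phi(r)=r^k\log(r)$ with $k\geq 4$ an even integer, or $\phi(r)=r^k$ with $k>2$ an odd integer, and set $\phi_A(P)=\phi(\|P-A\|)$. Let $\{P_h\}\subset\Omega$ and $\{Q_k\}\subset\partial\Omega$ be any two fixed sets of distinct collocation points, and let $\{A_i\}$ be a sequence of independent random points in $\mathbb{R}^d$ with possibly distinct probability densities $\sigma_i\in L^1_+(\mathbb{R}^d)$. Then for every $N=N_I+N_B$ with $N_I\geq 0$, $N_B\geq 1$, the $N\times N$ Kansa collocation matrix $K_N$, whose entries are $$(K_N)_{h,j}=\mathcal{L}\phi_{A_j}(P_h),\quad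 1\le h\le N_I,\ 1\le j\le N,$$ $$(K_N)_{N_I+l,\,j}=\mathcal{B}\phi_{A_j}(Q_l),\quad 1\le l\le N_B,\ 1\le j\le N,$$ is almost surely nonsingular.
   Context: A domain is a connected open set; points are written $P=(x_1,\dots,x_d)$. $\|\cdot\|$ and $\langle\cdot,\cdot\rangle$ are the Euclidean norm and inner product in $\mathbb{R}^d$, $\nabla=(\partial_{x_1},\dots,\partial_{x_d})$ is the gradient, and $\chi_S$ is the characteristic function of a set $S$. The coefficients $c_{ij}$ and $\rho$ are real-valued functions and $\vec b$ is an $\mathbb{R}^d$-valued vector field, on $\Omega$; $f$ and $g$ are the data of the problem and do not enter the matrix. $\vec\nu(P)$ is the (unit) normal vector at a boundary point $P$, and $\partial_\nu=\langle\nabla,\vec\nu\rangle$ is the normal derivative at that point; the normal is understood to exist at the boundary points where $\partial_\nu$ is used (those in $\Gamma_2$). In $\mathcal{L}\phi_A(P)$ and $\mathcal{B}\phi_A(P)$ all derivatives are taken with respect to the variable $P$, with the center $A=(a_1,\dots,a_d)$ fixed. The function $\phi(r)=r^k\log(r)$ (Thin-Plate Spline) is extended by continuity with $\phi(0)=0$. The restrictions on the exponent $k$ guarantee the existence of second derivatives of $\phi_A$ everywhere, including at $P=A$. No polynomial terms are added to the radial basis. The interior collocation points are $P_1,\dots,P_{N_I}$, the boundary collocation points are $Q_1,\dots,Q_{N_B}$, and the matrix $K_N$ uses the first $N$ random centers $A_1,\dots,A_N$; if $N_I=0$ only boundary rows are present. The index in $\{Q_k\}$ is unrelated to the exponent $k$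 of the radial function. Each $A_i$ has its law absolutely continuous with respect to Lebesgue measure, with density $\sigma_i$; $L^1_+(\mathbb{R}^d)$ denotes the nonnegative integrable functions. "Almost surely" refers to the joint law of the random centers. *)

theory Defs
  imports "HOL-Probability.Probability" "Jordan_Normal_Form.Determinant"
begin

(* "$" is kept for the components of real ^ 'n. *)
no_notation vec_index (infixl "$" 100)

(* Only the values on [0, infinity) matter. At r = 0 the first equation gives phi 0 = 0,
   the extension by continuity, because 0 ^ k = 0. *)
definition polyharmonic_spline :: "(real \<Rightarrow> real) \<Rightarrow> bool" where
  "polyharmonic_spline \<phi> \<longleftrightarrow>
     (\<exists>k::nat. even k \<and> k \<ge> 4 \<and> (\<forall>r\<ge>0. \<phi> r = r ^ k * ln r)) \<or>
     (\<exists>k::nat. odd k \<and> k > 2 \<and> (\<forall>r\<ge>0. \<phi> r = r ^ k))"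

definition radial :: "(real \<Rightarrow> real) \<Rightarrow> real ^ 'n \<Rightarrow> real ^ 'n \<Rightarrow> real" where
  "radial \<phi> A P = \<phi> (norm (P - A))"

definition partial_deriv :: "'n \<Rightarrow> (real ^ 'n \<Rightarrow> real) \<Rightarrow> real ^ 'n \<Rightarrow> real" where
  "partial_deriv i u P = deriv (\<lambda>t. u (P + t *\<^sub>R axis i 1)) 0"

definition gradient :: "(real ^ 'n \<Rightarrow> real) \<Rightarrow> real ^ 'n \<Rightarrow> real ^ 'n" where
  "gradient u P = (\<chi> i. partial_deriv i u P)"

definition elliptic_on :: "(real ^ 'n) set \<Rightarrow> ('n \<Rightarrow> 'n \<Rightarrow> real ^ 'n \<Rightarrow> real) \<Rightarrow> bool" where
  "elliptic_on \<Omega> c \<longleftrightarrow>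
     (\<forall>P\<in>\<Omega>. \<forall>\<xi>. \<xi> \<noteq> 0 \<longrightarrow> (\<Sum>i\<in>UNIV. \<Sum>j\<in>UNIV. c i j P * \<xi> $ i * \<xi> $ j) \<noteq> 0)"

definition interior_op ::
  "('n \<Rightarrow> 'n \<Rightarrow> real ^ 'n \<Rightarrow> real) \<Rightarrow> (real ^ 'n \<Rightarrow> real ^ 'n) \<Rightarrow> (real ^ 'n \<Rightarrow> real)
    \<Rightarrow> (real ^ 'n \<Rightarrow> real) \<Rightarrow> real ^ 'n \<Rightarrow> real" where
  "interior_op c b \<rho> u P =
     (\<Sum>i\<in>UNIV. \<Sum>j\<in>UNIV. c i j P * partial_deriv i (partial_deriv j u) P)
     + inner (gradient u P) (b P) + \<rho> P * u P"

definition boundary_op ::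
  "(real ^ 'n) set \<Rightarrow> (real ^ 'n) set \<Rightarrow> (real ^ 'n \<Rightarrow> real ^ 'n)
    \<Rightarrow> (real ^ 'n \<Rightarrow> real) \<Rightarrow> real ^ 'n \<Rightarrow> real" where
  "boundary_op \<Gamma>1 \<Gamma>2 \<nu> u P =
     indicat_real \<Gamma>1 P * u P + indicat_real \<Gamma>2 P * inner (gradient u P) (\<nu> P)"

(* The Bouligand (contingent) cone: all limits of rescaled secants of S at x. *)
definition tangent_cone :: "(real ^ 'n) set \<Rightarrow> real ^ 'n \<Rightarrow> (real ^ 'n) set" where
  "tangent_cone S x =
     {v. \<exists>y t. (\<forall>m::nat. y m \<in> S \<and> (t m :: real) > 0) \<and> t \<longlonglongrightarrow> 0 \<and>
               (\<lambda>m. (y m - x) /\<^sub>R t m) \<longlonglongrightarrow> v}"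

(* The boundary has a tangent hyperplane at x and n is a unit vector orthogonal to it.
   This determines n up to sign; no orientation (outward or inward) is imposed, and the
   domain may lie on both sides of its boundary. No regularity away from x is required. *)
definition unit_normal :: "(real ^ 'n) set \<Rightarrow> real ^ 'n \<Rightarrow> real ^ 'n \<Rightarrow> bool" where
  "unit_normal \<Omega> x n \<longleftrightarrow>
     norm n = 1 \<and> tangent_cone (frontier \<Omega>) x = {v. inner v n = 0}"

(* Rows, columns, collocation points and centers are all numbered from 0. *)
definition kansa_matrix ::
  "((real ^ 'n \<Rightarrow> real) \<Rightarrow> real ^ 'n \<Rightarrow> real) \<Rightarrow> ((real ^ 'n \<Rightarrow> real) \<Rightarrow> real ^ 'n \<Rightarrow> real)
    \<Rightarrow> (real \<Rightarrow> real) \<Rightarrow> nat \<Rightarrow> nat \<Rightarrow> (nat \<Rightarrow> real ^ 'n) \<Rightarrow> (nat \<Rightarrow> real ^ 'n)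
    \<Rightarrow> (nat \<Rightarrow> real ^ 'n) \<Rightarrow> real mat" where
  "kansa_matrix L B \<phi> NI NB P Q A =
     mat (NI + NB) (NI + NB)
       (\<lambda>(h, j). if h < NI then L (radial \<phi> (A j)) (P h)
                 else B (radial \<phi> (A j)) (Q (h - NI)))"

end

theory Submission
  imports Defs "HOL-Complex_Analysis.Complex_Analysis"
begin

text \<open>
  Expanding the determinant along its last column and conditioning on the other centers, it
  suffices that no nontrivial combination \<open>F A\<close> of the rows, as a function of a single center
  \<open>A\<close>, vanishes on a set of positive measure. By Fubini this may be checked on almost
  every line \<open>x + t v\<close>, for one suitable direction \<open>v\<close>. On such a line the row of the
  collocation point \<open>X\<close> has the form \<open>p t * \<psi> (ln ((t - a)\<^sup>2 + s\<^sup>2)) + e t\<close> with polynomials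
  \<open>p\<close>, \<open>e\<close>, where \<open>a + \<i> s\<close> encodes the foot of the perpendicular from \<open>X\<close> and its length, and
  \<open>\<psi> w\<close> is \<open>w / 2\<close> (even exponent) or \<open>exp (- w / 2)\<close> (odd exponent). If \<open>v\<close> is not orthogonal
  to any difference of collocation points, the branch points \<open>a \<plusminus> \<i> s\<close> of different rows
  have different real parts, so \<open>F\<close> continues analytically to the plane minus
  disjoint vertical slits. Were \<open>F\<close> constant, the jump of a row across its own slit would vanish;
  but \<open>\<psi>\<close> separates \<open>w + \<i> \<pi>\<close> from \<open>w - \<i> \<pi>\<close>, and \<open>p\<close> is not zero, by ellipticity
  for interior rows and because of the lower-order terms for boundary rows (the case \<open>c = 0\<close>).
\<close>

subsection \<open>Linear independence on a line\<close>

text \<open>An analytic branch of \<open>ln ((z - a)\<^sup>2 + s\<^sup>2)\<close> whose cuts are the vertical half-lines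
  going up from \<open>a + \<i> s\<close> and down from \<open>a - \<i> s\<close>.\<close>
definition slit_Ln :: "real \<Rightarrow> real \<Rightarrow> complex \<Rightarrow> complex" where
  "slit_Ln a s z = Ln (\<i> * (z - Complex a s)) + Ln (- \<i> * (z - Complex a (- s)))"

text \<open>On the real axis the two arguments of \<open>Ln\<close> are conjugate with real part
  \<open>s > 0\<close>, so the logarithms add up to twice the logarithm of the modulus.\<close>

lemma slit_Ln_of_real:
  assumes "s > 0"
  shows "slit_Ln a s (of_real t) = of_real (ln ((t - a)\<^sup>2 + s\<^sup>2))"
proof -
  define w where "w = Complex s (t - a)"
  have w: "\<i> * (of_real t - Complex a s) = w" "- \<i> * (of_real t - Complex a (- s)) = cnj w"
    by (simp_all add: w_def complex_eq_iff)
  have nr: "w \<notin> \<real>\<^sub>\<le>\<^sub>0" using assms by (simp add: w_def complex_nonpos_Reals_iff)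
  have w0: "w \<noteq> 0" using nr by auto
  have "slit_Ln a s (of_real t) = Ln w + cnj (Ln w)"
    unfolding slit_Ln_def w by (simp add: cnj_Ln[OF nr])
  also have "\<dots> = of_real (2 * ln (cmod w))"
    using w0 by (simp add: complex_add_cnj)
  also have "2 * ln (cmod w) = ln ((cmod w)\<^sup>2)" using w0 by (simp add: ln_realpow)
  also have "(cmod w)\<^sup>2 = (t - a)\<^sup>2 + s\<^sup>2" by (simp add: cmod_power2 w_def)
  finally show ?thesis .
qed

lemma holomorphic_on_slit_Ln:
  assumes "s > 0" and "\<And>z. z \<in> D \<Longrightarrow> Re z \<noteq> a \<or> \<bar>Im z\<bar> < s"
  shows "slit_Ln a s holomorphic_on D"
  unfolding slit_Ln_def
proof (intro holomorphic_intros)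
  fix z assume "z \<in> D"
  from assms(2)[OF this]
  show "\<i> * (z - Complex a s) \<notin> \<real>\<^sub>\<le>\<^sub>0" "- \<i> * (z - Complex a (- s)) \<notin> \<real>\<^sub>\<le>\<^sub>0"
    by (auto simp: complex_nonpos_Reals_iff)
qed

text \<open>Above the upper branch point only the first logarithm meets its cut; its one-sided
  limits lie symmetrically about a common value.\<close>

lemma slit_Ln_jump:
  assumes "s > 0" "y > s"
  obtains L where "((\<lambda>e. slit_Ln a s (Complex (a + e) y)) \<longlongrightarrow> L + \<i> * pi) (at_right 0)"
    and "((\<lambda>e. slit_Ln a s (Complex (a - e) y)) \<longlongrightarrow> L - \<i> * pi) (at_right 0)"
proof
  \<comment> \<open>The first argument is negated, which moves it into the right half-plane and
    makes \<open>M\<close> continuous at 0. Undoing the negation costs \<open>\<i> * pi\<close> on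
    the right of the slit and \<open>- \<i> * pi\<close> on the left.\<close>
  define M where "M e = Ln (Complex (y - s) (- e)) + Ln (Complex (y + s) (- e))" for e
  have cont: "continuous (at 0) M"
  proof -
    have c: "continuous (at 0) (\<lambda>e. Complex u (- e))" for u
      unfolding Complex_eq by (intro continuous_intros)
    have "isCont (\<lambda>e. Ln (Complex u (- e))) 0" if "u > 0" for u
      by (rule isCont_o2[OF c]) (use that in \<open>auto intro!: continuous_at_Ln simp: complex_nonpos_Reals_iff\<close>)
    then show ?thesis unfolding M_def using assms
      by (intro continuous_add) auto
  qed
  have lim: "(M \<longlongrightarrow> M 0) (at_right 0)"
    using cont by (auto simp: continuous_at intro: filterlim_at_within_not_equal tendsto_within_subset)
  have lim': "((\<lambda>e. M (- e)) \<longlongrightarrow> M 0) (at_right 0)"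
  proof -
    have "((\<lambda>e. M (- e)) \<longlongrightarrow> M (- 0)) (at_right 0)"
      by (rule continuous_within_tendsto_compose'[OF continuous_at_imp_continuous_at_within[of _ _ UNIV]])
         (use cont in \<open>auto intro!: tendsto_eq_intros\<close>)
    then show ?thesis by simp
  qed
  have 1: "slit_Ln a s (Complex (a + e) y) = M e + \<i> * pi" if "e > 0" for e
  proof -
    have eq: "Complex (- (y - s)) e = - Complex (y - s) (- e)" by (simp add: complex_eq_iff)
    have "Ln (Complex (- (y - s)) e) = Ln (Complex (y - s) (- e)) + \<i> * pi"
      unfolding eq using that assms by (subst Ln_minus) (auto simp: complex_eq_iff)
    moreover have "\<i> * (Complex (a + e) y - Complex a s) = Complex (- (y - s)) e"
      "- \<i> * (Complex (a + e) y - Complex a (- s)) = Complex (y + s) (- e)"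
      by (simp_all add: complex_eq_iff)
    ultimately show ?thesis unfolding slit_Ln_def M_def by simp
  qed
  have 2: "slit_Ln a s (Complex (a - e) y) = M (- e) - \<i> * pi" if "e > 0" for e
  proof -
    have eq: "Complex (- (y - s)) (- e) = - Complex (y - s) e" by (simp add: complex_eq_iff)
    have "Ln (Complex (- (y - s)) (- e)) = Ln (Complex (y - s) e) - \<i> * pi"
      unfolding eq using that assms by (subst Ln_minus) (auto simp: complex_eq_iff)
    moreover have "\<i> * (Complex (a - e) y - Complex a s) = Complex (- (y - s)) (- e)"
      "- \<i> * (Complex (a - e) y - Complex a (- s)) = Complex (y + s) e"
      by (simp_all add: complex_eq_iff)
    ultimately show ?thesis unfolding slit_Ln_def M_def by simp
  qed
  show "((\<lambda>e. slit_Ln a s (Complex (a + e) y)) \<longlongrightarrow> M 0 + \<i> * pi) (at_right 0)"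
    by (rule Lim_transform_eventually[OF tendsto_add[OF lim tendsto_const]])
       (auto simp: 1 eventually_at_filter)
  show "((\<lambda>e. slit_Ln a s (Complex (a - e) y)) \<longlongrightarrow> M 0 - \<i> * pi) (at_right 0)"
    by (rule Lim_transform_eventually[OF tendsto_diff[OF lim' tendsto_const]])
       (auto simp: 2 eventually_at_filter)
qed

text \<open>The sum continues to a holomorphic \<open>G\<close> on a connected set \<open>D\<close>.
  Distinct \<open>a h\<close> put the slits on distinct vertical lines, so across the slit of
  \<open>h0\<close> only the term of \<open>h0\<close> can jump, by a multiple of
  \<open>\<psi> (L + \<i> * pi) - \<psi> (L - \<i> * pi)\<close> that is nonzero at a suitable
  height. Hence \<open>G\<close> is not constant and has countably many zeros.\<close>

lemma countable_zeros_log_combination: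
  fixes p e :: "'i \<Rightarrow> complex poly" and \<psi> :: "complex \<Rightarrow> complex"
  assumes fin: "finite H" and inj: "inj_on a H" and pos: "\<And>h. h \<in> H \<Longrightarrow> s h > 0"
    and hol: "\<psi> holomorphic_on UNIV" and per: "\<And>w. \<psi> (w + \<i> * pi) \<noteq> \<psi> (w - \<i> * pi)"
    and h0: "h0 \<in> H" and p0: "p h0 \<noteq> 0"
  shows "countable {t::real. (\<Sum>h\<in>H. poly (p h) (of_real t) * \<psi> (of_real (ln ((t - a h)\<^sup>2 + (s h)\<^sup>2)))
                             + poly (e h) (of_real t)) = 0}"
proof -
  define D where "D = {z. \<forall>h\<in>H. Re z \<noteq> a h \<or> \<bar>Im z\<bar> < s h}"
  define T where "T h z = poly (p h) z * \<psi> (slit_Ln (a h) (s h) z) + poly (e h) z" for h z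
  define G where "G z = (\<Sum>h\<in>H. T h z)" for z
  have "D = - (\<Union>h\<in>H. {z. Re z = a h} \<inter> {z. s h \<le> \<bar>Im z\<bar>})"
    by (auto simp: D_def)
  moreover have "closed (\<Union>h\<in>H. {z. Re z = a h} \<inter> {z. s h \<le> \<bar>Im z\<bar>})"
    using fin by (intro closed_UN closed_Int closed_Collect_eq closed_Collect_le continuous_intros ballI)
  ultimately have "open D" by (simp only: open_closed[symmetric] open_Compl)
  \<comment> \<open>Each point of \<open>D\<close> is joined to the real axis by a vertical segment
    inside \<open>D\<close>, and the real axis lies in \<open>D\<close> because all
    \<open>s h\<close> are positive.\<close>
  have "connected D"
  proof -
    have reals: "of_real t \<in> D" for t using pos by (auto simp: D_def)
    have seg: "closed_segment (of_real (Re z)) z \<subseteq> D" if "z \<in> D" for z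
    proof
      fix w assume "w \<in> closed_segment (of_real (Re z)) z"
      then obtain u where u: "0 \<le> u" "u \<le> 1" "w = (1 - u) *\<^sub>R of_real (Re z) + u *\<^sub>R z"
        by (auto simp: closed_segment_def)
      have "Re w = Re z" "\<bar>Im w\<bar> = u * \<bar>Im z\<bar>"
        unfolding u(3) using u(1) by (auto simp: algebra_simps abs_mult)
      moreover have "u * \<bar>Im z\<bar> \<le> \<bar>Im z\<bar>" using u by (simp add: mult_left_le_one_le)
      ultimately show "w \<in> D" using that by (force simp: D_def)
    qed
    have "connected (range (of_real :: real \<Rightarrow> complex))"
      by (intro connected_continuous_image continuous_intros) auto
    then have conn: "connected (range of_real \<union> closed_segment (of_real (Re z)) z)" for z
      by (intro connected_Un) auto
    have "connected (\<Union>z\<in>D. range of_real \<union> closed_segment (of_real (Re z)) z)"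
    proof (rule connected_Union)
      show "\<Inter> ((\<lambda>z. range of_real \<union> closed_segment (of_real (Re z)) z) ` D) \<noteq> {}"
        by (auto intro!: exI[of _ 0] image_eqI[of _ _ 0])
    qed (use conn in auto)
    also have "(\<Union>z\<in>D. range of_real \<union> closed_segment (of_real (Re z)) z) = D"
      using reals seg by auto
    finally show ?thesis .
  qed
  have hol\<psi>: "(\<lambda>z. \<psi> (f z)) holomorphic_on A" if "f holomorphic_on A" for f A
    using holomorphic_on_compose_gen[OF that hol] by (auto simp: o_def)
  have holT: "T h holomorphic_on D" if "h \<in> H" for h
    unfolding T_def using that pos
    by (intro holomorphic_intros hol\<psi> holomorphic_on_slit_Ln) (auto simp: D_def)
  then have holG: "G holomorphic_on D"
    unfolding G_def by (intro holomorphic_intros) auto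
  have nconst: "\<not> G constant_on D"
  proof
    assume "G constant_on D"
    then obtain \<kappa> where \<kappa>: "\<And>z. z \<in> D \<Longrightarrow> G z = \<kappa>" by (auto simp: constant_on_def)
    \<comment> \<open>Infinitely many heights above the branch point face finitely many roots of
      \<open>p h0\<close>, so some slit point is not a root.\<close>
    have inf: "infinite ((\<lambda>y. Complex (a h0) y) ` {s h0<..})"
      by (subst finite_image_iff) (auto simp: inj_on_def infinite_Ioi)
    have "\<not> (\<lambda>y. Complex (a h0) y) ` {s h0<..} \<subseteq> {z. poly (p h0) z = 0}"
      using inf poly_roots_finite[OF p0] finite_subset by blast
    then obtain y where y: "y > s h0" "poly (p h0) (Complex (a h0) y) \<noteq> 0" by auto
    define z0 where "z0 = Complex (a h0) y"
    have lim: "((\<lambda>e. Complex (a h0 + e) y) \<longlongrightarrow> z0) (at_right 0)"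
      "((\<lambda>e. Complex (a h0 - e) y) \<longlongrightarrow> z0) (at_right 0)"
      unfolding z0_def by (auto intro!: tendsto_eq_intros)
    \<comment> \<open>For small \<open>e > 0\<close> neither \<open>a h0 + e\<close> nor
      \<open>a h0 - e\<close> equals any of the finitely many \<open>a h\<close>, that of
      \<open>h0\<close> included.\<close>
    have inD: "\<forall>\<^sub>F e in at_right 0. Complex (a h0 + e) y \<in> D \<and> Complex (a h0 - e) y \<in> D"
    proof -
      have "\<forall>\<^sub>F e in at_right 0. \<forall>h\<in>H. a h0 + e \<noteq> a h \<and> a h0 - e \<noteq> a h"
      proof (subst eventually_ball_finite_distrib[OF fin], intro ballI eventually_conj)
        fix h
        have ne: "\<forall>\<^sub>F e in at_right (0::real). e \<noteq> c" for c
          by (cases "c > 0") (auto simp: eventually_at_right_field intro: exI[of _ c] exI[of _ 1])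
        show "\<forall>\<^sub>F e in at_right 0. a h0 + e \<noteq> a h"
          using ne[of "a h - a h0"] by (rule eventually_mono) auto
        show "\<forall>\<^sub>F e in at_right 0. a h0 - e \<noteq> a h"
          using ne[of "a h0 - a h"] by (rule eventually_mono) auto
      qed
      then show ?thesis by (auto elim!: eventually_mono simp: D_def)
    qed
    have cont: "isCont \<psi> w" for w
      using holomorphic_on_imp_continuous_on[OF hol] by (simp add: continuous_on_eq_continuous_at)
    \<comment> \<open>\<open>J h e\<close> compares the term of \<open>h\<close> at two points
      facing each other across the slit of \<open>h0\<close>. For \<open>h \<noteq> h0\<close> the
      term is holomorphic off the line \<open>Re z = a h\<close>, hence continuous at
      \<open>z0\<close>.\<close>
    define J where "J h e = T h (Complex (a h0 + e) y) - T h (Complex (a h0 - e) y)" for h e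
    have J0: "(J h \<longlongrightarrow> 0) (at_right 0)" if h: "h \<in> H" "h \<noteq> h0" for h
    proof -
      have "a h \<noteq> a h0" using inj h h0 by (auto simp: inj_on_def)
      have op: "open {z. Re z \<noteq> a h}"
        by (intro open_Collect_neq continuous_intros)
      have "T h holomorphic_on {z. Re z \<noteq> a h}"
        unfolding T_def using h pos
        by (intro holomorphic_intros hol\<psi> holomorphic_on_slit_Ln) auto
      then have "continuous_on {z. Re z \<noteq> a h} (T h)" by (rule holomorphic_on_imp_continuous_on)
      then have cT: "isCont (T h) z0"
        using op \<open>a h \<noteq> a h0\<close> by (simp add: continuous_on_eq_continuous_at z0_def)
      from tendsto_diff[OF isCont_tendsto_compose[OF cT lim(1)] isCont_tendsto_compose[OF cT lim(2)]]
      show ?thesis by (simp add: J_def[abs_def])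
    qed
    obtain L where L: "((\<lambda>e. slit_Ln (a h0) (s h0) (Complex (a h0 + e) y)) \<longlongrightarrow> L + \<i> * pi) (at_right 0)"
      "((\<lambda>e. slit_Ln (a h0) (s h0) (Complex (a h0 - e) y)) \<longlongrightarrow> L - \<i> * pi) (at_right 0)"
      using slit_Ln_jump[OF pos[OF h0] y(1)] by metis
    have poly_lim: "((\<lambda>e. poly r (u e)) \<longlongrightarrow> poly r z0) F" if "(u \<longlongrightarrow> z0) F" for r u and F :: "real filter"
      by (rule isCont_tendsto_compose[OF poly_isCont that])
    have "(J h0 \<longlongrightarrow> (poly (p h0) z0 * \<psi> (L + \<i> * pi) + poly (e h0) z0)
                 - (poly (p h0) z0 * \<psi> (L - \<i> * pi) + poly (e h0) z0)) (at_right 0)"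
      unfolding J_def T_def
      by (rule tendsto_diff; rule tendsto_add; (rule tendsto_mult)?; rule poly_lim[OF lim(1)] poly_lim[OF lim(2)]
            isCont_tendsto_compose[OF cont L(1)] isCont_tendsto_compose[OF cont L(2)])
    then have J1: "(J h0 \<longlongrightarrow> poly (p h0) z0 * (\<psi> (L + \<i> * pi) - \<psi> (L - \<i> * pi))) (at_right 0)"
      by (simp add: algebra_simps)
    have "((\<lambda>e. J h0 e + (\<Sum>h\<in>H - {h0}. J h e)) \<longlongrightarrow>
        poly (p h0) z0 * (\<psi> (L + \<i> * pi) - \<psi> (L - \<i> * pi)) + (\<Sum>h\<in>H - {h0}. 0)) (at_right 0)"
      by (intro tendsto_add J1 tendsto_sum J0) auto
    moreover have "J h0 e + (\<Sum>h\<in>H - {h0}. J h e) = G (Complex (a h0 + e) y) - G (Complex (a h0 - e) y)" for e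
      using sum.remove[OF fin h0, of "\<lambda>h. J h e"] by (simp add: J_def G_def sum_subtractf)
    ultimately have lim1: "((\<lambda>e. G (Complex (a h0 + e) y) - G (Complex (a h0 - e) y)) \<longlongrightarrow>
        poly (p h0) z0 * (\<psi> (L + \<i> * pi) - \<psi> (L - \<i> * pi))) (at_right 0)" by simp
    have "((\<lambda>e. G (Complex (a h0 + e) y) - G (Complex (a h0 - e) y)) \<longlongrightarrow> 0) (at_right 0)"
      by (rule tendsto_eventually) (use inD in \<open>auto elim!: eventually_mono simp: \<kappa>\<close>)
    from tendsto_unique[OF _ this lim1] show False
      using y per[of L] by (auto simp: z0_def)
  qed
  obtain K where "\<And>n::nat. compact (K n)" "\<Union> (range K) = D"
    using open_Union_compact_subsets[OF \<open>open D\<close>] by metis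
  then have "fsigma D" unfolding fsigma_Union_compact by (intro exI[of _ K]) auto
  then have "countable {z\<in>D. G z = 0}"
    using holG \<open>open D\<close> \<open>connected D\<close> nconst by (intro holomorphic_countable_zeros)
  moreover have "(\<Sum>h\<in>H. poly (p h) (of_real t) * \<psi> (of_real (ln ((t - a h)\<^sup>2 + (s h)\<^sup>2)))
      + poly (e h) (of_real t)) = G (of_real t)" for t
    unfolding G_def T_def by (rule sum.cong) (auto simp: slit_Ln_of_real pos)
  moreover have "of_real t \<in> D" for t
    using pos by (auto simp: D_def)
  ultimately show ?thesis
    by (intro countable_image_inj_on[where f = "of_real :: real \<Rightarrow> complex"])
       (auto intro: countable_subset[rotated] simp: inj_on_def)
qed

subsection \<open>Null sets via lines\<close>

text \<open>Fubini for the pairs \<open>(x, t)\<close>: countable sets of \<open>t\<close> are null,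
  so after exchanging the order some fixed \<open>t\<close> has
  \<open>x + t *\<^sub>R v \<notin> Z\<close> for almost all \<open>x\<close>. Translation
  invariance then removes the shift.\<close>

lemma AE_lborel_lines:
  fixes v :: "'a::euclidean_space"
  assumes Z: "Z \<in> sets borel"
    and lines: "AE x in lborel. countable {t::real. x + t *\<^sub>R v \<in> Z}"
  shows "AE x in lborel. x \<notin> Z"
proof -
  have meas: "{u\<in>space (lborel \<Otimes>\<^sub>M lborel). fst u + snd u *\<^sub>R v \<notin> Z} \<in> sets (lborel \<Otimes>\<^sub>M (lborel :: real measure))"
    using Z by measurable
  have "AE x in lborel. AE t in lborel. x + (t::real) *\<^sub>R v \<notin> Z"
    using lines
  proof (rule eventually_mono)
    fix x assume "countable {t::real. x + t *\<^sub>R v \<in> Z}"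
    then show "AE t in lborel. x + t *\<^sub>R v \<notin> Z"
      by (intro AE_I'[OF countable_imp_null_set_lborel]) auto
  qed
  then have "AE t in (lborel::real measure). AE x in lborel. x + t *\<^sub>R v \<notin> Z"
    using lborel_pair.AE_commute[OF meas] by simp
  then obtain t :: real where "AE x in lborel. x + t *\<^sub>R v \<notin> Z"
    using eventually_happens[of _ "ae_filter (lborel :: real measure)"]
    by (auto simp: ae_filter_eq_bot_iff)
  then have "AE x in distr lborel borel ((+) (t *\<^sub>R v)). x \<notin> Z"
    using Z by (subst AE_distr_iff) (auto simp: add.commute)
  then show ?thesis unfolding lborel_distr_plus .
qed

text \<open>The exceptional \<open>x\<close> form a line through \<open>p\<close>, which is null in
  dimension at least 2.\<close>

lemma AE_lborel_avoid_line:
  fixes p v :: "'a::euclidean_space"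
  assumes "DIM('a) \<ge> 2"
  shows "AE x in lborel. \<forall>t::real. x + t *\<^sub>R v \<noteq> p"
proof -
  have "negligible (span {v})"
    using assms dim_singleton[of v] by (intro negligible_lowdim) auto
  then have "negligible ((+) p ` span {v})" by (rule negligible_translation)
  then have "(+) p ` span {v} \<in> null_sets lebesgue" by (simp add: negligible_iff_null_sets)
  then have "AE x in lebesgue. x \<notin> (+) p ` span {v}" by (rule AE_not_in)
  then have "AE x in lborel. x \<notin> (+) p ` span {v}" by (simp add: AE_completion_iff)
  then show ?thesis
  proof (rule AE_mp, intro AE_I2 impI allI notI)
    fix x t assume "x \<notin> (+) p ` span {v}" "x + t *\<^sub>R v = p"
    then have "x = p + (- t) *\<^sub>R v" by (auto simp: algebra_simps)
    moreover have "(- t) *\<^sub>R v \<in> span {v}" by (intro span_scale span_base) simp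
    ultimately show False using \<open>x \<notin> _\<close> by blast
  qed
qed

lemma exists_unit_vector_not_orthogonal:
  fixes W :: "'a::euclidean_space set"
  assumes "finite W" "0 \<notin> W"
  obtains v where "norm v = 1" "\<And>w. w \<in> W \<Longrightarrow> inner w v \<noteq> 0"
proof -
  \<comment> \<open>Finitely many hyperplanes do not cover the space. Adding \<open>b\<close> to the
    normals forces \<open>u \<noteq> 0\<close> even when \<open>W\<close> is empty.\<close>
  obtain b :: 'a where b: "b \<in> Basis" using nonempty_Basis by blast
  have "negligible (\<Union>w\<in>insert b W. {x. inner w x = 0})"
    using assms b nonzero_Basis by (intro negligible_Union) (auto intro!: negligible_hyperplane)
  then have "(\<Union>w\<in>insert b W. {x. inner w x = 0}) \<noteq> UNIV"
    using non_negligible_UNIV by metis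
  then obtain u where u: "\<And>w. w \<in> insert b W \<Longrightarrow> inner w u \<noteq> 0" by blast
  from u[of b] have "u \<noteq> 0" by auto
  show thesis
    by (rule that[of "u /\<^sub>R norm u"]) (use u \<open>u \<noteq> 0\<close> in auto)
qed

subsection \<open>Differential operators on radial functions\<close>

definition quad_form :: "('n \<Rightarrow> 'n \<Rightarrow> real) \<Rightarrow> real ^ 'n \<Rightarrow> real" where
  "quad_form C \<xi> = (\<Sum>i\<in>UNIV. \<Sum>j\<in>UNIV. C i j * \<xi> $ i * \<xi> $ j)"

text \<open>The derivative of \<open>g\<close> is given with a factor \<open>norm (P - A)\<close> so
  that it cancels the denominator in the derivative of the norm.\<close>

lemma has_real_derivative_radial:
  fixes A P v :: "real ^ 'n"
  assumes "P \<noteq> A" and g: "(g has_real_derivative norm (P - A) * g') (at (norm (P - A)))"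
  shows "((\<lambda>t. radial g A (P + t *\<^sub>R v)) has_real_derivative inner (P - A) v * g') (at 0)"
proof -
  define \<xi> where "\<xi> = P - A"
  have \<xi>: "\<xi> \<noteq> 0" "inner \<xi> \<xi> > 0" using assms by (simp_all add: \<xi>_def)
  have *: "norm (P + t *\<^sub>R v - A) = sqrt (inner \<xi> \<xi> + 2 * t * inner \<xi> v + t\<^sup>2 * inner v v)" for t
  proof -
    have "P + t *\<^sub>R v - A = \<xi> + t *\<^sub>R v" by (simp add: \<xi>_def)
    then show ?thesis
      by (simp add: norm_eq_sqrt_inner inner_add_left inner_add_right inner_commute power2_eq_square algebra_simps)
  qed
  have n: "((\<lambda>t. norm (P + t *\<^sub>R v - A)) has_real_derivative inner \<xi> v / norm \<xi>) (at 0)"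
    unfolding * using \<xi> by (auto intro!: derivative_eq_intros simp: norm_eq_sqrt_inner inner_ge_zero[THEN leD] field_simps)
  have "(g has_real_derivative norm \<xi> * g') (at (norm (P + 0 *\<^sub>R v - A)))"
    using g by (simp add: \<xi>_def)
  from DERIV_chain2[OF this n] have "((\<lambda>t. g (norm (P + t *\<^sub>R v - A))) has_real_derivative norm \<xi> * g' * (inner \<xi> v / norm \<xi>)) (at 0)"
    .
  then show ?thesis using \<xi> unfolding radial_def \<xi>_def[symmetric] by (simp add: field_simps)
qed

text \<open>Here \<open>\<phi>'\<close> and \<open>\<phi>''\<close> are not derivatives but the
  first and second iterates of \<open>(1/r) d/dr\<close>. With them the Hessian is
  \<open>\<phi>''\<close> times the products of coordinates of \<open>P - A\<close>, plus
  \<open>\<phi>'\<close> on the diagonal.\<close>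

lemma interior_op_radial:
  fixes A P :: "real ^ 'n"
  assumes PA: "P \<noteq> A"
    and \<phi>: "\<And>r. r > 0 \<Longrightarrow> (\<phi> has_real_derivative r * \<phi>' r) (at r)"
    and \<phi>': "\<And>r. r > 0 \<Longrightarrow> (\<phi>' has_real_derivative r * \<phi>'' r) (at r)"
  shows "interior_op c b \<rho> (radial \<phi> A) P =
    \<phi>'' (norm (P - A)) * quad_form (\<lambda>i j. c i j P) (P - A)
    + \<phi>' (norm (P - A)) * ((\<Sum>i\<in>UNIV. c i i P) + inner (P - A) (b P)) + \<rho> P * \<phi> (norm (P - A))"
proof -
  define \<xi> where "\<xi> = P - A"
  define r where "r = norm \<xi>"
  have first: "partial_deriv j (radial \<phi> A) Y = (Y - A) $ j * \<phi>' (norm (Y - A))" if "Y \<noteq> A" for j Y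
  proof -
    have "((\<lambda>t. radial \<phi> A (Y + t *\<^sub>R axis j 1)) has_real_derivative
        inner (Y - A) (axis j 1) * \<phi>' (norm (Y - A))) (at 0)"
      using that by (intro has_real_derivative_radial \<phi>) auto
    then show ?thesis
      unfolding partial_deriv_def by (simp add: DERIV_imp_deriv inner_axis)
  qed
  have second: "partial_deriv i (partial_deriv j (radial \<phi> A)) P =
      \<xi> $ i * \<xi> $ j * \<phi>'' r + (if i = j then \<phi>' r else 0)" for i j
  proof -
    \<comment> \<open>\<open>first\<close> holds only off \<open>A\<close>; to differentiate it once
      more, the shifted points must stay off \<open>A\<close> for small \<open>t\<close>.\<close>
    have "((\<lambda>t. P + t *\<^sub>R axis i (1::real)) \<longlongrightarrow> P + 0 *\<^sub>R axis i 1) (nhds 0)"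
      by (intro tendsto_intros filterlim_ident)
    then have "((\<lambda>t. P + t *\<^sub>R axis i (1::real)) \<longlongrightarrow> P) (nhds 0)" by simp
    then have "\<forall>\<^sub>F t in nhds 0. P + t *\<^sub>R axis i 1 \<noteq> A"
      using PA by (rule tendsto_imp_eventually_ne)
    then have "\<forall>\<^sub>F t in nhds 0. partial_deriv j (radial \<phi> A) (P + t *\<^sub>R axis i 1)
        = (P + t *\<^sub>R axis i 1 - A) $ j * radial \<phi>' A (P + t *\<^sub>R axis i 1)"
      by (rule eventually_mono) (simp add: first radial_def)
    then have "partial_deriv i (partial_deriv j (radial \<phi> A)) P =
        deriv (\<lambda>t. (P + t *\<^sub>R axis i 1 - A) $ j * radial \<phi>' A (P + t *\<^sub>R axis i 1)) 0"
      unfolding partial_deriv_def[of i] by (rule deriv_cong_ev) simp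
    also have "\<dots> = \<xi> $ i * \<xi> $ j * \<phi>'' r + (if i = j then \<phi>' r else 0)"
    proof (rule DERIV_imp_deriv)
      have "((\<lambda>t. \<xi> $ j + t * axis i 1 $ j) has_real_derivative axis i 1 $ j) (at 0)"
        by (auto intro!: derivative_eq_intros)
      moreover have "(\<lambda>t. (P + t *\<^sub>R axis i 1 - A) $ j) = (\<lambda>t. \<xi> $ j + t * axis i 1 $ j)"
        by (auto simp: \<xi>_def)
      moreover have "((\<lambda>t. radial \<phi>' A (P + t *\<^sub>R axis i 1)) has_real_derivative \<xi> $ i * \<phi>'' r) (at 0)"
        using has_real_derivative_radial[OF PA \<phi>', of "axis i 1"] PA by (simp add: r_def \<xi>_def inner_axis)
      moreover have "axis i (1::real) $ j = (if i = j then 1 else 0)"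
        by (simp add: axis_def)
      ultimately show "((\<lambda>t. (P + t *\<^sub>R axis i 1 - A) $ j * radial \<phi>' A (P + t *\<^sub>R axis i 1))
          has_real_derivative (\<xi> $ i * \<xi> $ j * \<phi>'' r + (if i = j then \<phi>' r else 0))) (at 0)"
        by (auto intro!: derivative_eq_intros simp: radial_def r_def \<xi>_def)
    qed
    finally show ?thesis .
  qed
  have "(\<Sum>i\<in>UNIV. \<Sum>j\<in>UNIV. c i j P * partial_deriv i (partial_deriv j (radial \<phi> A)) P)
      = \<phi>'' r * quad_form (\<lambda>i j. c i j P) \<xi> + \<phi>' r * (\<Sum>i\<in>UNIV. c i i P)"
    unfolding second quad_form_def
    by (simp add: distrib_left sum.distrib sum_distrib_left mult.assoc mult.left_commute
      if_distrib[of "\<lambda>x. _ * x"] mult_ac cong: if_cong)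
  moreover have "gradient (radial \<phi> A) P = \<phi>' r *\<^sub>R \<xi>"
    using PA by (simp add: gradient_def first Finite_Cartesian_Product.vec_eq_iff r_def \<xi>_def)
  ultimately show ?thesis
    unfolding interior_op_def by (simp add: r_def \<xi>_def radial_def distrib_left)
qed

text \<open>Up to the analytic factor \<open>norm \<xi> ^ (k - 4)\<close> or \<open>norm \<xi> ^ (k - 3)\<close>, the coefficient of the
  non-analytic factor (\<open>ln (norm \<xi>)\<close> or \<open>1 / norm \<xi>\<close>) of the operator applied to the spline;
  \<open>regular_part\<close> is the analytic remainder for even \<open>k\<close>.\<close>
definition principal_part ::
  "nat \<Rightarrow> ('n \<Rightarrow> 'n \<Rightarrow> real) \<Rightarrow> real ^ 'n \<Rightarrow> real \<Rightarrow> real ^ 'n \<Rightarrow> real" where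
  "principal_part k C \<beta> \<gamma> \<xi> =
     real k * (real k - 2) * quad_form C \<xi> + real k * (norm \<xi>)\<^sup>2 * ((\<Sum>i\<in>UNIV. C i i) + inner \<xi> \<beta>)
     + \<gamma> * (norm \<xi>) ^ 4"

definition regular_part ::
  "nat \<Rightarrow> ('n \<Rightarrow> 'n \<Rightarrow> real) \<Rightarrow> real ^ 'n \<Rightarrow> real ^ 'n \<Rightarrow> real" where
  "regular_part k C \<beta> \<xi> =
     2 * (real k - 1) * quad_form C \<xi> + (norm \<xi>)\<^sup>2 * ((\<Sum>i\<in>UNIV. C i i) + inner \<xi> \<beta>)"

text \<open>With \<open>k = 2 * m + 4\<close>, applying \<open>(1/r) d/dr\<close> once and twice
  gives powers \<open>k - 2\<close> and \<open>k - 4\<close> of \<open>r\<close> times expressions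
  linear in \<open>ln r\<close>. Collecting the coefficient of \<open>ln r\<close> yields
  \<open>principal_part\<close>; the rest is \<open>regular_part\<close>.\<close>

lemma interior_op_even_spline:
  fixes A P :: "real ^ 'n"
  assumes "P \<noteq> A" and \<phi>: "\<And>r. r \<ge> 0 \<Longrightarrow> \<phi> r = r ^ (2 * m + 4) * ln r"
  shows "interior_op c b \<rho> (radial \<phi> A) P =
    (norm (P - A)) ^ (2 * m) *
      (principal_part (2 * m + 4) (\<lambda>i j. c i j P) (b P) (\<rho> P) (P - A) * ln (norm (P - A))
       + regular_part (2 * m + 4) (\<lambda>i j. c i j P) (b P) (P - A))"
proof -
  let ?k = "real (2 * m + 4)"
  let ?\<phi> = "\<lambda>r. r ^ (2 * m + 4) * ln r"
  have "radial \<phi> A = radial ?\<phi> A" by (simp add: radial_def fun_eq_iff \<phi>)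
  moreover have "interior_op c b \<rho> (radial ?\<phi> A) P =
      (norm (P - A)) ^ (2 * m) * ((?k - 2) * (?k * ln (norm (P - A)) + 1) + ?k) * quad_form (\<lambda>i j. c i j P) (P - A)
    + (norm (P - A)) ^ (2 * m + 2) * (?k * ln (norm (P - A)) + 1) * ((\<Sum>i\<in>UNIV. c i i P) + inner (P - A) (b P))
    + \<rho> P * ?\<phi> (norm (P - A))"
  proof (rule interior_op_radial[where \<phi> = ?\<phi> and \<phi>' = "\<lambda>r. r ^ (2 * m + 2) * (?k * ln r + 1)" and \<phi>'' = "\<lambda>r. r ^ (2 * m) * ((?k - 2) * (?k * ln r + 1) + ?k)", OF assms(1)])
    fix r :: real assume "r > 0"
    show "(?\<phi> has_real_derivative r * (r ^ (2 * m + 2) * (?k * ln r + 1))) (at r)"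
      by (rule DERIV_cong[OF DERIV_mult[OF DERIV_pow DERIV_ln[OF \<open>r > 0\<close>]]])
         (use \<open>r > 0\<close> in \<open>simp add: field_simps power_add eval_nat_numeral\<close>)
    show "((\<lambda>r. r ^ (2 * m + 2) * (?k * ln r + 1)) has_real_derivative r * (r ^ (2 * m) * ((?k - 2) * (?k * ln r + 1) + ?k))) (at r)"
      by (rule DERIV_cong[OF DERIV_mult[OF DERIV_pow DERIV_add[OF DERIV_cmult[OF DERIV_ln[OF \<open>r > 0\<close>]] DERIV_const]]])
         (use \<open>r > 0\<close> in \<open>simp add: field_simps power_add eval_nat_numeral\<close>)
  qed
  ultimately show ?thesis
    by (simp add: principal_part_def regular_part_def algebra_simps power_add eval_nat_numeral)
qed

text \<open>With \<open>k = 2 * m + 3\<close> the second iterate of \<open>(1/r) d/dr\<close> has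
  exponent \<open>k - 4 = 2 * m - 1\<close>, written as \<open>r ^ (2 * m) / r\<close> to keep the
  exponent a natural number when \<open>m = 0\<close>.\<close>

lemma interior_op_odd_spline:
  fixes A P :: "real ^ 'n"
  assumes "P \<noteq> A" and \<phi>: "\<And>r. r \<ge> 0 \<Longrightarrow> \<phi> r = r ^ (2 * m + 3)"
  shows "interior_op c b \<rho> (radial \<phi> A) P =
    (norm (P - A)) ^ (2 * m) *
      (principal_part (2 * m + 3) (\<lambda>i j. c i j P) (b P) (\<rho> P) (P - A) / norm (P - A))"
proof -
  let ?k = "real (2 * m + 3)"
  let ?\<phi> = "\<lambda>r::real. r ^ (2 * m + 3)"
  have "radial \<phi> A = radial ?\<phi> A" by (simp add: radial_def fun_eq_iff \<phi>)
  moreover have "interior_op c b \<rho> (radial ?\<phi> A) P =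
      (?k * (?k - 2) * (norm (P - A)) ^ (2 * m) / norm (P - A)) * quad_form (\<lambda>i j. c i j P) (P - A)
    + (?k * (norm (P - A)) ^ (2 * m + 1)) * ((\<Sum>i\<in>UNIV. c i i P) + inner (P - A) (b P))
    + \<rho> P * ?\<phi> (norm (P - A))"
  proof (rule interior_op_radial[where \<phi> = ?\<phi> and \<phi>' = "\<lambda>r. ?k * r ^ (2 * m + 1)" and \<phi>'' = "\<lambda>r. ?k * (?k - 2) * r ^ (2 * m) / r", OF assms(1)])
    fix r :: real assume "r > 0"
    show "(?\<phi> has_real_derivative r * (?k * r ^ (2 * m + 1))) (at r)"
      by (rule DERIV_cong[OF DERIV_pow])
         (use \<open>r > 0\<close> in \<open>simp add: field_simps power_add eval_nat_numeral\<close>)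
    show "((\<lambda>r. ?k * r ^ (2 * m + 1)) has_real_derivative r * (?k * (?k - 2) * r ^ (2 * m) / r)) (at r)"
      by (rule DERIV_cong[OF DERIV_cmult[OF DERIV_pow]])
         (use \<open>r > 0\<close> in \<open>simp add: field_simps power_add eval_nat_numeral\<close>)
  qed
  ultimately show ?thesis
    using assms(1) by (simp add: principal_part_def field_simps power_add eval_nat_numeral)
qed

subsection \<open>Random collocation determinants\<close>

lemma invertible_mat_of_det_nonzero:
  fixes A :: "'a::field mat"
  assumes A: "A \<in> carrier_mat n n" and "Determinant.det A \<noteq> 0"
  shows "invertible_mat A"
proof -
  have "A \<in> Units (ring_mat TYPE('a) n ())" using assms by (rule det_non_zero_imp_unit)
  then obtain B where "B \<in> carrier_mat n n" "A * B = 1\<^sub>m n" "B * A = 1\<^sub>m n"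
    by (auto simp: Units_def ring_mat_def)
  with A show ?thesis by (auto simp: invertible_mat_def inverts_mat_def square_mat.simps)
qed

text \<open>Induction on leading minors: expanded along its last column, the determinant is a
  combination of the \<open>f i\<close> at the new point whose coefficients depend on the earlier
  points only. The coefficient of \<open>f m\<close> is the preceding minor, almost surely nonzero,
  so \<open>nz\<close> applies for almost every choice of the earlier points.\<close>

lemma AE_PiM_det_nonzero:
  fixes f :: "nat \<Rightarrow> 'b \<Rightarrow> real" and D :: "nat \<Rightarrow> 'b measure"
  assumes prob: "\<And>j. prob_space (D j)"
    and meas: "\<And>i j. i < n \<Longrightarrow> f i \<in> borel_measurable (D j)"
    and nz: "\<And>j \<alpha>. \<exists>i<n. \<alpha> i \<noteq> 0 \<Longrightarrow> AE y in D j. (\<Sum>i<n. \<alpha> i * f i y) \<noteq> 0"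
    and "m \<le> n"
  shows "AE g in PiM {..<m} D. Determinant.det (mat m m (\<lambda>(i, j). f i (g j))) \<noteq> 0"
  using \<open>m \<le> n\<close>
proof (induction m)
  case 0
  then show ?case by simp
next
  case (Suc m)
  let ?P = "PiM {..<m} D"
  \<comment> \<open>The cofactor of entry \<open>(i, m)\<close>, written in the first
    \<open>m\<close> points only.\<close>
  define C where "C i g = (-1) ^ (i + m) *
    Determinant.det (mat m m (\<lambda>(i', j'). f (if i' < i then i' else Suc i') (g j')))" for i :: nat and g
  \<comment> \<open>The row selection \<open>r\<close> covers both the full matrix and the minors in
    \<open>C\<close>.\<close>
  have det_meas: "(\<lambda>g. Determinant.det (mat l l (\<lambda>(i, j). f (r i) (g j)))) \<in> borel_measurable (PiM {..<l} D)"
    if "\<And>i. i < l \<Longrightarrow> r i < n" for l and r :: "nat \<Rightarrow> nat"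
  proof -
    have entry: "(\<lambda>g. f (r i) (g j)) \<in> borel_measurable (PiM {..<l} D)" if "i < l" "j < l" for i j
      using measurable_compose[OF measurable_component_singleton[of j "{..<l}" D] meas[OF \<open>\<And>i. i < l \<Longrightarrow> r i < n\<close>[OF that(1)]]] that(2)
      by simp
    have "(\<lambda>g. mat l l (\<lambda>(i, j). f (r i) (g j)) $$ (i, p i)) \<in> borel_measurable (PiM {..<l} D)"
      if "p permutes {0..<l}" "i \<in> {0..<l}" for p i
      using entry[of i "p i"] permutes_in_image[OF that(1), of i] that(2) by simp
    then show ?thesis
      unfolding Determinant.det_def
      by (auto intro!: borel_measurable_times borel_measurable_sum borel_measurable_prod)
  qed
  have C_meas: "C i \<in> borel_measurable ?P" for i
    unfolding C_def[abs_def] using Suc.prems by (intro borel_measurable_times det_meas) auto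
  have det_eq: "Determinant.det (mat (Suc m) (Suc m) (\<lambda>(i, j). f i ((g(m := x)) j)))
      = (\<Sum>i<Suc m. C i g * f i x)" for g x
  proof -
    let ?A = "mat (Suc m) (Suc m) (\<lambda>(i, j). f i ((g(m := x)) j))"
    have "Determinant.det ?A = (\<Sum>i<Suc m. ?A $$ (i, m) * cofactor ?A i m)"
      by (rule laplace_expansion_column) auto
    also have "\<dots> = (\<Sum>i<Suc m. C i g * f i x)"
    proof (rule sum.cong)
      fix i assume i: "i \<in> {..<Suc m}"
      have "mat_delete ?A i m = mat m m (\<lambda>(i', j'). f (if i' < i then i' else Suc i') (g j'))"
        by (rule eq_matI) (use i in \<open>auto simp: mat_delete_def\<close>)
      then show "?A $$ (i, m) * cofactor ?A i m = C i g * f i x"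
        using i by (simp add: cofactor_def C_def)
    qed simp
    finally show ?thesis .
  qed
  interpret Dm: prob_space "D m" by (rule prob)
  interpret P: prob_space ?P by (rule prob_space_PiM) (rule prob)
  interpret pair_sigma_finite "D m" ?P ..
  \<comment> \<open>Deleting the last row shifts no index and the sign is 1, so this is the
    determinant of the induction hypothesis.\<close>
  have "C m g = (-1) ^ (m + m) * Determinant.det (mat m m (\<lambda>(i, j). f i (g j)))" for g
    unfolding C_def by (intro arg_cong2[where f = "(*)"] refl arg_cong[where f = Determinant.det] eq_matI) auto
  with Suc have "AE g in ?P. C m g \<noteq> 0" by simp
  then have ae: "AE g in ?P. AE x in D m. (\<Sum>i<Suc m. C i g * f i x) \<noteq> 0"
  proof (rule eventually_mono)
    fix g assume "C m g \<noteq> 0"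
    then have "AE x in D m. (\<Sum>i<n. (if i < Suc m then C i g else 0) * f i x) \<noteq> 0"
      using Suc.prems by (intro nz exI[of _ m]) auto
    moreover have "(\<Sum>i<n. (if i < Suc m then C i g else 0) * f i x) = (\<Sum>i<Suc m. C i g * f i x)" for x
      using Suc.prems by (intro sum.mono_neutral_cong_right) auto
    ultimately show "AE x in D m. (\<Sum>i<Suc m. C i g * f i x) \<noteq> 0" by simp
  qed
  have sum_meas: "(\<lambda>u. \<Sum>i<Suc m. C i (snd u) * f i (fst u)) \<in> borel_measurable (D m \<Otimes>\<^sub>M ?P)"
  proof (intro borel_measurable_sum borel_measurable_times measurable_compose[OF measurable_snd C_meas])
    fix i assume "i \<in> {..<Suc m}"
    then have "i < n" using Suc.prems by simp
    from measurable_compose[OF measurable_fst meas[OF this]]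
    show "(\<lambda>u. f i (fst u)) \<in> borel_measurable (D m \<Otimes>\<^sub>M ?P)" .
  qed
  then have set: "{u \<in> space (D m \<Otimes>\<^sub>M ?P). (\<Sum>i<Suc m. C i (snd u) * f i (fst u)) \<noteq> 0} \<in> sets (D m \<Otimes>\<^sub>M ?P)"
    by measurable
  \<comment> \<open>\<open>ae\<close> fixes \<open>g\<close> first, while the product carries the
    new point as first component; hence the exchange of order.\<close>
  have "AE u in D m \<Otimes>\<^sub>M ?P. (\<Sum>i<Suc m. C i (snd u) * f i (fst u)) \<noteq> 0"
    using AE_pair_iff[OF set] AE_commute[OF set] ae by simp
  then have ae_pair: "AE u in D m \<Otimes>\<^sub>M ?P.
      Determinant.det (mat (Suc m) (Suc m) (\<lambda>(i, j). f i (((snd u)(m := fst u)) j))) \<noteq> 0"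
    by (simp only: det_eq)
  have det_set: "{g \<in> space (PiM {..<Suc m} D). Determinant.det (mat (Suc m) (Suc m) (\<lambda>(i, j). f i (g j))) \<noteq> 0}
      \<in> sets (PiM {..<Suc m} D)"
    using Suc.prems by (intro borel_measurable_neq det_meas) auto
  have upd: "(\<lambda>u. (snd u)(m := fst u)) \<in> D m \<Otimes>\<^sub>M ?P \<rightarrow>\<^sub>M PiM {..<Suc m} D"
    unfolding lessThan_Suc by (rule measurable_fun_upd[where J = "{..<m}"]) auto
  have PiM_eq: "PiM {..<Suc m} D = distr (D m \<Otimes>\<^sub>M ?P) (PiM {..<Suc m} D) (\<lambda>u. (snd u)(m := fst u))"
    unfolding lessThan_Suc using distr_pair_PiM_eq_PiM[of "{..<m}" D m] prob by (simp add: case_prod_unfold)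
  from ae_pair have "AE g in distr (D m \<Otimes>\<^sub>M ?P) (PiM {..<Suc m} D) (\<lambda>u. (snd u)(m := fst u)).
      Determinant.det (mat (Suc m) (Suc m) (\<lambda>(i, j). f i (g j))) \<noteq> 0"
    by (simp only: AE_distr_iff[OF upd det_set])
  then show ?case by (simp only: PiM_eq[symmetric])
qed

text \<open>Independence makes the joint law of the first \<open>n\<close> points a product measure.
  The case \<open>n = 0\<close> is apart because that characterisation is applied to a nonempty
  index set; the empty determinant is 1.\<close>

lemma (in prob_space) AE_det_nonzero:
  fixes f :: "nat \<Rightarrow> 'b \<Rightarrow> real" and X :: "nat \<Rightarrow> 'a \<Rightarrow> 'b"
  assumes indep: "indep_vars (\<lambda>_. N) X UNIV"
    and meas: "\<And>i. i < n \<Longrightarrow> f i \<in> borel_measurable N"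
    and nz: "\<And>j \<alpha>. \<exists>i<n. \<alpha> i \<noteq> 0 \<Longrightarrow> AE y in distr M N (X j). (\<Sum>i<n. \<alpha> i * f i y) \<noteq> 0"
  shows "AE \<omega> in M. Determinant.det (mat n n (\<lambda>(i, j). f i (X j \<omega>))) \<noteq> 0"
proof (cases "n = 0")
  case False
  have rv: "random_variable N (X j)" for j
    using indep by (auto simp: indep_vars_def)
  have "indep_vars (\<lambda>_. N) X {..<n}"
    by (rule indep_vars_subset[OF indep]) simp
  then have distr: "distr M (PiM {..<n} (\<lambda>_. N)) (\<lambda>\<omega>. \<lambda>j\<in>{..<n}. X j \<omega>) = PiM {..<n} (\<lambda>j. distr M N (X j))"
    using False by (subst (asm) indep_vars_iff_distr_eq_PiM) (auto intro: rv)
  have "AE g in PiM {..<n} (\<lambda>j. distr M N (X j)). Determinant.det (mat n n (\<lambda>(i, j). f i (g j))) \<noteq> 0"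
    by (rule AE_PiM_det_nonzero[where n = n]) (use meas nz in \<open>auto intro: prob_space_distr rv\<close>)
  moreover have "(\<lambda>\<omega>. \<lambda>j\<in>{..<n}. X j \<omega>) \<in> M \<rightarrow>\<^sub>M PiM {..<n} (\<lambda>_. N)"
    by (intro measurable_restrict rv)
  ultimately have "AE \<omega> in M. Determinant.det (mat n n (\<lambda>(i, j). f i ((\<lambda>j\<in>{..<n}. X j \<omega>) j))) \<noteq> 0"
    unfolding distr[symmetric] by (rule AE_distrD[rotated])
  moreover have "mat n n (\<lambda>(i, j). f i ((\<lambda>j\<in>{..<n}. X j \<omega>) j)) = mat n n (\<lambda>(i, j). f i (X j \<omega>))" for \<omega>
    by (rule eq_matI) auto
  ultimately show ?thesis by simp
qed simp

subsection \<open>Collocation rows on lines\<close>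

text \<open>The punctured space is connected in dimension at least 2, so its image is an interval
  that misses 0.\<close>

lemma quad_form_same_sign:
  fixes C :: "'n::finite \<Rightarrow> 'n \<Rightarrow> real" and u w :: "real ^ 'n"
  assumes "CARD('n) \<ge> 2" and def: "\<And>\<xi> :: real ^ 'n. \<xi> \<noteq> 0 \<Longrightarrow> quad_form C \<xi> \<noteq> 0"
    and "u \<noteq> 0" "w \<noteq> 0"
  shows "quad_form C u * quad_form C w > 0"
proof (rule ccontr)
  have conn: "connected (quad_form C ` (- {0}))"
    unfolding quad_form_def using assms(1)
    by (intro connected_continuous_image continuous_intros connected_punctured_universe) auto
  have in_im: "quad_form C u \<in> quad_form C ` (- {0})" "quad_form C w \<in> quad_form C ` (- {0})" using assms by auto
  assume "\<not> quad_form C u * quad_form C w > 0"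
  then have "quad_form C u < 0 \<and> quad_form C w > 0 \<or> quad_form C u > 0 \<and> quad_form C w < 0"
    using def[OF \<open>u \<noteq> 0\<close>] def[OF \<open>w \<noteq> 0\<close>] by (auto simp: zero_less_mult_iff)
  then have "0 \<in> quad_form C ` (- {0})"
    using connectedD_interval[OF conn in_im, of 0] connectedD_interval[OF conn in_im(2,1), of 0] by auto
  then obtain \<xi> :: "real ^ 'n" where "\<xi> \<in> - {0}" "0 = quad_form C \<xi>" by (rule imageE)
  then show False using def[of \<xi>] by simp
qed

lemma quad_form_axis: "quad_form C (axis i 1) = C i i"
  by (simp add: quad_form_def axis_def if_distrib[of "\<lambda>x. _ * x"] cong: if_cong)

text \<open>Diagonal entries are values of the form at unit vectors, so the trace has the sign of
  \<open>quad_form C v\<close> and nothing can cancel.\<close>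

lemma quad_form_plus_trace_nonzero:
  fixes C :: "'n::finite \<Rightarrow> 'n \<Rightarrow> real" and v :: "real ^ 'n"
  assumes "CARD('n) \<ge> 2" and "\<And>\<xi> :: real ^ 'n. \<xi> \<noteq> 0 \<Longrightarrow> quad_form C \<xi> \<noteq> 0"
    and "v \<noteq> 0" and "r > 0" "r' > 0"
  shows "r * quad_form C v + r' * (\<Sum>i\<in>UNIV. C i i) \<noteq> 0"
proof
  assume eq: "r * quad_form C v + r' * (\<Sum>i\<in>UNIV. C i i) = 0"
  have "quad_form C v * C i i > 0" for i
    using quad_form_same_sign[OF assms(1,2) \<open>v \<noteq> 0\<close>, of "axis i 1"] by (simp add: quad_form_axis axis_eq_0_iff)
  then have "quad_form C v * (\<Sum>i\<in>UNIV. C i i) > 0"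
    unfolding sum_distrib_left by (intro sum_pos) auto
  moreover have "quad_form C v * quad_form C v > 0" by (rule quad_form_same_sign) (use assms in auto)
  ultimately have "r * (quad_form C v * quad_form C v) + r' * (quad_form C v * (\<Sum>i\<in>UNIV. C i i)) > 0"
    by (intro add_pos_pos mult_pos_pos[OF \<open>r > 0\<close>] mult_pos_pos[OF \<open>r' > 0\<close>])
  also have "\<dots> = quad_form C v * (r * quad_form C v + r' * (\<Sum>i\<in>UNIV. C i i))"
    by (simp add: algebra_simps)
  finally show False using eq by simp
qed

text \<open>Along a line the squared norm, the quadratic form and the inner product are the
  polynomials \<open>q\<close>, \<open>qC\<close>, \<open>qB\<close> in \<open>t\<close>, and both
  parts are built from these.\<close>

lemma parts_on_line:
  fixes C :: "'n::finite \<Rightarrow> 'n \<Rightarrow> real" and y v :: "real ^ 'n"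
  assumes card: "CARD('n) \<ge> 2" and v: "norm v = 1" and k: "k \<ge> 3"
    and nondeg: "\<gamma> \<noteq> 0 \<or> inner \<beta> v \<noteq> 0 \<or> (\<beta> = 0 \<and> (\<forall>\<xi> :: real ^ 'n. \<xi> \<noteq> 0 \<longrightarrow> quad_form C \<xi> \<noteq> 0))"
  shows "\<exists>(p :: complex poly) (e :: complex poly). p \<noteq> 0 \<and>
    (\<forall>t. poly p (of_real t) = of_real (norm (y - t *\<^sub>R v) ^ (2 * m) * principal_part k C \<beta> \<gamma> (y - t *\<^sub>R v))) \<and>
    (\<forall>t. poly e (of_real t) = of_real (norm (y - t *\<^sub>R v) ^ (2 * m) * regular_part k C \<beta> (y - t *\<^sub>R v)))"
proof -
  let ?c = "of_real :: real \<Rightarrow> complex"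
  \<comment> \<open>The cross term of the quadratic form, with both orders because \<open>C\<close>
    may be asymmetric.\<close>
  define bil where "bil = (\<Sum>i\<in>UNIV. \<Sum>j\<in>UNIV. C i j * (y $ i * v $ j + v $ i * y $ j))"
  define tr where "tr = (\<Sum>i\<in>UNIV. C i i)"
  define q where "q = [:?c (inner y y), - 2 * ?c (inner y v), 1:]"
  define qC where "qC = [:?c (quad_form C y), - ?c bil, ?c (quad_form C v):]"
  define qB where "qB = [:?c (tr + inner y \<beta>), - ?c (inner v \<beta>):]"
  define W where "W = Polynomial.smult (?c (real k * (real k - 2))) qC + Polynomial.smult (?c k) (q * qB) + Polynomial.smult (?c \<gamma>) (q * q)"
  define R where "R = Polynomial.smult (?c (2 * (real k - 1))) qC + q * qB"
  have vv: "inner v v = 1" using v by (simp add: norm_eq_1)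
  have sq: "(norm (y - t *\<^sub>R v))\<^sup>2 = inner y y - 2 * t * inner y v + t * t" for t
    unfolding power2_norm_eq_inner
    by (simp add: inner_diff_left inner_diff_right vv inner_commute[of v y] algebra_simps)
  have q: "poly q (of_real t) = of_real ((norm (y - t *\<^sub>R v))\<^sup>2)" for t
    unfolding sq by (simp add: q_def algebra_simps)
  have quad_line: "quad_form C (y - t *\<^sub>R v) = quad_form C y - t * bil + t * t * quad_form C v" for t
    unfolding quad_form_def bil_def
    by (simp add: algebra_simps sum.distrib sum_subtractf sum_distrib_left)
  have qC: "poly qC (of_real t) = of_real (quad_form C (y - t *\<^sub>R v))" for t
    unfolding quad_line by (simp add: qC_def algebra_simps)
  have qB: "poly qB (of_real t) = of_real (tr + inner (y - t *\<^sub>R v) \<beta>)" for t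
    by (simp add: qB_def inner_diff_left)
  \<comment> \<open>The coefficients of \<open>t^4\<close>, \<open>t^3\<close>, \<open>t^2\<close> successively force \<open>\<gamma>\<close>, \<open>inner \<beta> v\<close> and finally
    a positive combination of \<open>quad_form C v\<close> and the trace to vanish; the latter have the same sign.\<close>
  have "W \<noteq> 0"
  proof
    assume W0: "W = 0"
    have "Polynomial.coeff W 4 = ?c \<gamma>"
      by (simp add: W_def q_def qC_def qB_def numeral_eq_Suc)
    with W0 have \<gamma>: "\<gamma> = 0" by simp
    have "Polynomial.coeff W 3 = - ?c (k * inner v \<beta>)"
      by (simp add: W_def q_def qC_def qB_def numeral_eq_Suc \<gamma>)
    with W0 k have "inner v \<beta> = 0" by simp
    with nondeg \<gamma> have \<beta>: "\<beta> = 0" and ell: "\<And>\<xi> :: real ^ 'n. \<xi> \<noteq> 0 \<Longrightarrow> quad_form C \<xi> \<noteq> 0"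
      by (auto simp: inner_commute)
    have "Polynomial.coeff W 2 = ?c (real k * (real k - 2) * quad_form C v + real k * tr)"
      by (simp add: W_def q_def qC_def qB_def numeral_eq_Suc \<gamma> \<beta>)
    moreover have "real k * (real k - 2) * quad_form C v + real k * tr \<noteq> 0"
      unfolding tr_def using k v by (intro quad_form_plus_trace_nonzero[OF card ell]) auto
    ultimately show False using W0 by (metis coeff_0 of_real_eq_0_iff)
  qed
  moreover have "q \<noteq> 0" by (simp add: q_def)
  ultimately have "q ^ m * W \<noteq> 0" by simp
  moreover have "poly (q ^ m * W) (of_real t) =
      of_real (norm (y - t *\<^sub>R v) ^ (2 * m) * principal_part k C \<beta> \<gamma> (y - t *\<^sub>R v))" for t
  proof -
    have "(norm \<xi>) ^ 4 = (norm \<xi>)\<^sup>2 * (norm \<xi>)\<^sup>2" for \<xi> :: "real ^ 'n"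
      by (simp flip: power_add)
    then show ?thesis
      unfolding W_def principal_part_def tr_def[symmetric]
      by (simp add: q qC qB power_mult mult.assoc)
  qed
  moreover have "poly (q ^ m * R) (of_real t) =
      of_real (norm (y - t *\<^sub>R v) ^ (2 * m) * regular_part k C \<beta> (y - t *\<^sub>R v))" for t
    unfolding R_def regular_part_def tr_def[symmetric] by (simp add: q qC qB power_mult)
  ultimately show ?thesis by (intro exI[of _ "q ^ m * W"] exI[of _ "q ^ m * R"] conjI allI)
qed

text \<open>A common shape for both families: \<open>g l\<close> is \<open>l / 2\<close> with
  \<open>\<kappa> = 1\<close> for even exponents, and \<open>exp (- l / 2)\<close> with
  \<open>\<kappa> = 0\<close> for odd ones. The logarithm of the squared norm is used because on a
  line that square is a polynomial.\<close>

definition spline_row ::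
  "(real \<Rightarrow> real) \<Rightarrow> nat \<Rightarrow> nat \<Rightarrow> real \<Rightarrow> ('n \<Rightarrow> 'n \<Rightarrow> real) \<Rightarrow> real ^ 'n \<Rightarrow> real \<Rightarrow> real ^ 'n \<Rightarrow> real" where
  "spline_row g k m \<kappa> C \<beta> \<gamma> \<xi> =
     norm \<xi> ^ (2 * m) * principal_part k C \<beta> \<gamma> \<xi> * g (ln ((norm \<xi>)\<^sup>2))
     + \<kappa> * (norm \<xi> ^ (2 * m) * regular_part k C \<beta> \<xi>)"

text \<open>\<open>\<psi>\<close> is the entire extension of \<open>g\<close>. Between
  \<open>w + \<i> * pi\<close> and \<open>w - \<i> * pi\<close> it changes by
  \<open>\<i> * pi\<close> in the even case and flips its nonzero value in the odd case.\<close>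

lemma spline_normal_form:
  assumes "polyharmonic_spline \<phi>"
  obtains g :: "real \<Rightarrow> real" and \<psi> :: "complex \<Rightarrow> complex" and k m :: nat and \<kappa> :: real
  where "k \<ge> 3" and "g \<in> borel_measurable borel"
    and "\<psi> holomorphic_on UNIV" and "\<And>l. \<psi> (of_real l) = of_real (g l)"
    and "\<And>w. \<psi> (w + \<i> * pi) \<noteq> \<psi> (w - \<i> * pi)"
    and "\<And>c b \<rho> (P :: real ^ 'n) A. P \<noteq> A \<Longrightarrow> interior_op c b \<rho> (radial \<phi> A) P =
      spline_row g k m \<kappa> (\<lambda>i j. c i j P) (b P) (\<rho> P) (P - A)"
proof -
  consider k where "even k" "k \<ge> 4" "\<And>r. r \<ge> 0 \<Longrightarrow> \<phi> r = r ^ k * ln r"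
    | k where "odd k" "k > 2" "\<And>r. r \<ge> 0 \<Longrightarrow> \<phi> r = r ^ k"
    using assms by (auto simp: polyharmonic_spline_def)
  then show thesis
  proof cases
    case 1
    define m where "m = (k - 4) div 2"
    have k: "k = 2 * m + 4" using 1 unfolding m_def by presburger
    show thesis
    proof (rule that[of k "\<lambda>l. l / 2" "\<lambda>w. w / 2" m 1])
      fix c b \<rho> and P A :: "real ^ 'n" assume "P \<noteq> A"
      then show "interior_op c b \<rho> (radial \<phi> A) P =
        spline_row (\<lambda>l. l / 2) k m 1 (\<lambda>i j. c i j P) (b P) (\<rho> P) (P - A)"
        using interior_op_even_spline[of P A \<phi> m c b \<rho>] 1 k
        by (simp add: spline_row_def ln_realpow distrib_left)
    qed (use 1 in \<open>auto intro!: holomorphic_intros\<close>)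
  next
    case 2
    define m where "m = (k - 3) div 2"
    have k: "k = 2 * m + 3" using 2 unfolding m_def by presburger
    show thesis
    proof (rule that[of k "\<lambda>l. exp (- l / 2)" "\<lambda>w. exp (- w / 2)" m 0])
      fix c b \<rho> and P A :: "real ^ 'n" assume PA: "P \<noteq> A"
      have "exp (- ln ((norm (P - A))\<^sup>2) / 2) = 1 / norm (P - A)"
        using PA by (simp add: ln_realpow exp_minus field_simps)
      with PA show "interior_op c b \<rho> (radial \<phi> A) P =
        spline_row (\<lambda>l. exp (- l / 2)) k m 0 (\<lambda>i j. c i j P) (b P) (\<rho> P) (P - A)"
        using interior_op_odd_spline[of P A \<phi> m c b \<rho>] 2 k by (simp add: spline_row_def)
    next
      fix w
      have e1: "exp (\<i> * pi / 2) = \<i>" using cis_conv_exp[of "pi / 2"] by simp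
      then have e2: "exp (- (\<i> * pi / 2)) = - \<i>" by (simp add: exp_minus)
      have e3: "exp (- (w + \<i> * pi) / 2) = exp (- w / 2) * exp (- (\<i> * pi / 2))"
        "exp (- (w - \<i> * pi) / 2) = exp (- w / 2) * exp (\<i> * pi / 2)"
        unfolding exp_add[symmetric] by (rule arg_cong[where f = exp], simp add: field_simps)+
      show "exp (- (w + \<i> * pi) / 2) \<noteq> exp (- (w - \<i> * pi) / 2)"
        unfolding e3 e1 e2 by (simp add: complex_eq_iff[of "- \<i>"])
    qed (use 2 in \<open>auto intro!: holomorphic_intros simp: exp_of_real[symmetric]\<close>)
  qed
qed


lemma borel_measurable_spline_row [measurable (raw)]:
  fixes C :: "'n::finite \<Rightarrow> 'n \<Rightarrow> real" and \<beta> :: "real ^ 'n"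
  assumes [measurable]: "g \<in> borel_measurable borel" and [measurable]: "f \<in> borel_measurable M"
  shows "(\<lambda>x. spline_row g k m \<kappa> C \<beta> \<gamma> (f x)) \<in> borel_measurable M"
proof -
  have [measurable]: "quad_form C \<in> borel_measurable borel"
    unfolding quad_form_def by (intro borel_measurable_continuous_onI continuous_intros)
  show ?thesis unfolding spline_row_def principal_part_def regular_part_def by measurable
qed

text \<open>Pythagoras, with the foot of the perpendicular at \<open>t = inner y v\<close>.\<close>

lemma norm_square_on_line:
  fixes y v :: "'a::real_inner"
  assumes "norm v = 1"
  shows "(norm (y - t *\<^sub>R v))\<^sup>2 = (t - inner y v)\<^sup>2 + (norm (y - inner y v *\<^sub>R v))\<^sup>2"
proof -
  have "inner v v = 1" using assms by (simp add: norm_eq_1)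
  then show ?thesis
    unfolding power2_norm_eq_inner
    by (simp add: inner_diff_left inner_diff_right inner_commute[of v y] power2_eq_square algebra_simps)
qed

lemma AE_row_combination_nonzero:
  fixes X B :: "nat \<Rightarrow> real ^ 'n" and C :: "nat \<Rightarrow> 'n::finite \<Rightarrow> 'n \<Rightarrow> real" and \<gamma> \<alpha> :: "nat \<Rightarrow> real"
  assumes card: "CARD('n) \<ge> 2" and inj: "inj_on X {..<n}"
    and nondeg: "\<And>h. h < n \<Longrightarrow> \<gamma> h \<noteq> 0 \<or> B h \<noteq> 0 \<or> (\<forall>\<xi> :: real ^ 'n. \<xi> \<noteq> 0 \<longrightarrow> quad_form (C h) \<xi> \<noteq> 0)"
    and k: "k \<ge> 3" and g: "g \<in> borel_measurable borel"
    and \<psi>: "\<psi> holomorphic_on UNIV" "\<And>l. \<psi> (of_real l) = of_real (g l)"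
      "\<And>w. \<psi> (w + \<i> * pi) \<noteq> \<psi> (w - \<i> * pi)"
    and \<alpha>: "\<exists>h<n. \<alpha> h \<noteq> 0"
  shows "AE A in lborel. (\<Sum>h<n. \<alpha> h * spline_row g k m \<kappa> (C h) (B h) (\<gamma> h) (X h - A)) \<noteq> 0"
proof -
  \<comment> \<open>Differences of collocation points are included to make the feet
    \<open>a h\<close> distinct, nonzero \<open>B h\<close> to keep \<open>inner (B h) v\<close>
    nonzero.\<close>
  define W where "W = (\<lambda>(h, h'). X h - X h') ` {(h, h'). h < n \<and> h' < n \<and> h \<noteq> h'} \<union> B ` {h. h < n \<and> B h \<noteq> 0}"
  have "finite {(h, h'). h < n \<and> h' < n \<and> h \<noteq> h'}"
    by (rule finite_subset[of _ "{..<n} \<times> {..<n}"]) auto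
  then have "finite W" by (simp add: W_def)
  moreover have "0 \<notin> W" using inj by (auto simp: W_def inj_on_def)
  ultimately obtain v where v: "norm v = 1" "\<And>w. w \<in> W \<Longrightarrow> inner w v \<noteq> 0"
    using exists_unit_vector_not_orthogonal by blast
  define Z where "Z = {A. (\<Sum>h<n. \<alpha> h * spline_row g k m \<kappa> (C h) (B h) (\<gamma> h) (X h - A)) = 0}"
  have "Z \<in> sets borel"
    unfolding Z_def using g by measurable
  moreover have "AE x in lborel. countable {t::real. x + t *\<^sub>R v \<in> Z}"
  proof -
    \<comment> \<open>Almost every line misses all collocation points, which makes every distance
      \<open>s h\<close> positive.\<close>
    have "AE x in lborel. \<forall>h\<in>{..<n}. \<forall>t::real. x + t *\<^sub>R v \<noteq> X h"
      using card by (intro AE_ball_countable[THEN iffD2] ballI AE_lborel_avoid_line) auto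
    then show ?thesis
    proof (rule eventually_mono)
      fix x assume off: "\<forall>h\<in>{..<n}. \<forall>t::real. x + t *\<^sub>R v \<noteq> X h"
      define y where "y h = X h - x" for h
      define a where "a h = inner (y h) v" for h
      define s where "s h = norm (y h - a h *\<^sub>R v)" for h
      have "\<exists>(p :: complex poly) (e :: complex poly). p \<noteq> 0 \<and>
          (\<forall>t. poly p (of_real t) = of_real (norm (y h - t *\<^sub>R v) ^ (2 * m) * principal_part k (C h) (B h) (\<gamma> h) (y h - t *\<^sub>R v))) \<and>
          (\<forall>t. poly e (of_real t) = of_real (norm (y h - t *\<^sub>R v) ^ (2 * m) * regular_part k (C h) (B h) (y h - t *\<^sub>R v)))"
        if h: "h \<in> {..<n}" for h
      proof -
        have nd: "\<gamma> h \<noteq> 0 \<or> inner (B h) v \<noteq> 0 \<or> (B h = 0 \<and> (\<forall>\<xi> :: real ^ 'n. \<xi> \<noteq> 0 \<longrightarrow> quad_form (C h) \<xi> \<noteq> 0))"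
          using nondeg[of h] h v(2)[of "B h"] by (auto simp: W_def)
        show ?thesis
          by (rule parts_on_line[OF card v(1) k nd])
      qed
      then obtain p e :: "nat \<Rightarrow> complex poly" where pe: "\<And>h. h \<in> {..<n} \<Longrightarrow> p h \<noteq> 0"
        "\<And>h t. h \<in> {..<n} \<Longrightarrow> poly (p h) (of_real t) =
          of_real (norm (y h - t *\<^sub>R v) ^ (2 * m) * principal_part k (C h) (B h) (\<gamma> h) (y h - t *\<^sub>R v))"
        "\<And>h t. h \<in> {..<n} \<Longrightarrow> poly (e h) (of_real t) =
          of_real (norm (y h - t *\<^sub>R v) ^ (2 * m) * regular_part k (C h) (B h) (y h - t *\<^sub>R v))"
        by metis
      have "inj_on a {..<n}"
      proof (rule inj_onI, rule ccontr)
        fix h h' assume h: "h \<in> {..<n}" "h' \<in> {..<n}" "a h = a h'" "h \<noteq> h'"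
        then have "X h - X h' \<in> W" by (force simp: W_def)
        from v(2)[OF this] h(3) show False by (simp add: a_def y_def inner_diff_left)
      qed
      moreover have "s h > 0" if "h \<in> {..<n}" for h
      proof -
        have "x + a h *\<^sub>R v \<noteq> X h" using off that by blast
        then show ?thesis by (auto simp: s_def y_def algebra_simps)
      qed
      moreover obtain h0 where h0: "h0 \<in> {..<n}" "\<alpha> h0 \<noteq> 0" using \<alpha> by auto
      ultimately have "countable {t::real. (\<Sum>h\<in>{..<n}. poly (Polynomial.smult (\<alpha> h) (p h)) (of_real t)
            * \<psi> (of_real (ln ((t - a h)\<^sup>2 + (s h)\<^sup>2)))
          + poly (Polynomial.smult (\<alpha> h * \<kappa>) (e h)) (of_real t)) = 0}"
        using \<psi> pe(1) by (intro countable_zeros_log_combination[where ?h0.0 = h0]) auto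
      also have "(\<lambda>t. \<Sum>h\<in>{..<n}. poly (Polynomial.smult (\<alpha> h) (p h)) (of_real t)
            * \<psi> (of_real (ln ((t - a h)\<^sup>2 + (s h)\<^sup>2)))
          + poly (Polynomial.smult (\<alpha> h * \<kappa>) (e h)) (of_real t))
          = (\<lambda>t. of_real (\<Sum>h<n. \<alpha> h * spline_row g k m \<kappa> (C h) (B h) (\<gamma> h) (X h - (x + t *\<^sub>R v))))"
      proof (rule ext, unfold of_real_sum, rule sum.cong)
        fix t h assume h: "h \<in> {..<n}"
        have shift: "X h - (x + t *\<^sub>R v) = y h - t *\<^sub>R v" by (simp add: y_def)
        have sq: "(t - a h)\<^sup>2 + (s h)\<^sup>2 = (norm (y h - t *\<^sub>R v))\<^sup>2"
          unfolding a_def s_def by (rule norm_square_on_line[OF v(1), symmetric])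
        show "poly (Polynomial.smult (\<alpha> h) (p h)) (of_real t)
            * \<psi> (of_real (ln ((t - a h)\<^sup>2 + (s h)\<^sup>2)))
          + poly (Polynomial.smult (\<alpha> h * \<kappa>) (e h)) (of_real t)
          = of_real (\<alpha> h * spline_row g k m \<kappa> (C h) (B h) (\<gamma> h) (X h - (x + t *\<^sub>R v)))"
          unfolding shift sq by (simp add: pe(2,3)[OF h] \<psi>(2) spline_row_def distrib_left mult.assoc)
      qed simp
      finally show "countable {t::real. x + t *\<^sub>R v \<in> Z}"
        by (simp add: Z_def del: of_real_sum)
    qed
  qed
  ultimately have "AE x in lborel. x \<notin> Z" by (rule AE_lborel_lines)
  then show ?thesis by (simp add: Z_def)
qed

text \<open>Boundary rows become interior rows without second-order part, so one normal form serves
  all rows.\<close>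

lemma boundary_op_eq_interior_op:
  "boundary_op \<Gamma>1 \<Gamma>2 \<nu> =
     interior_op (\<lambda>_ _ _. 0) (\<lambda>P. indicat_real \<Gamma>2 P *\<^sub>R \<nu> P) (indicat_real \<Gamma>1)"
  by (simp add: fun_eq_iff boundary_op_def interior_op_def)

lemma AE_distr_of_AE_lborel:
  fixes X :: "'a \<Rightarrow> 'b::euclidean_space"
  assumes "distributed M lborel X f" and "AE x in lborel. P x"
  shows "AE x in distr M borel X. P x"
proof -
  have "distr M borel X = distr M lborel X" by (intro distr_cong) auto
  also have "\<dots> = density lborel f" using assms(1) by (simp add: distributed_def)
  finally have eq: "distr M borel X = density lborel f" .
  show ?thesis
    unfolding eq using assms distributed_borel_measurable[OF assms(1)] by (subst AE_density) auto
qed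

section \<open>From independent rows to the random collocation matrix\<close>

theorem theorem1:
  fixes \<Omega> \<Gamma>1 \<Gamma>2 :: "(real ^ 'n) set"
    and c :: "'n \<Rightarrow> 'n \<Rightarrow> real ^ 'n \<Rightarrow> real"
    and b :: "real ^ 'n \<Rightarrow> real ^ 'n"
    and \<rho> :: "real ^ 'n \<Rightarrow> real"
    and \<nu> :: "real ^ 'n \<Rightarrow> real ^ 'n"
    and \<phi> :: "real \<Rightarrow> real"
    and NI NB :: nat
    and P Q :: "nat \<Rightarrow> real ^ 'n"
    and M :: "'w measure"
    and A :: "nat \<Rightarrow> 'w \<Rightarrow> real ^ 'n"
    and \<sigma> :: "nat \<Rightarrow> real ^ 'n \<Rightarrow> real"
  assumes "CARD('n) \<ge> 2"
    and "open \<Omega>" and "connected \<Omega>" and "bounded \<Omega>"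
    and "frontier \<Omega> = \<Gamma>1 \<union> \<Gamma>2" and "\<Gamma>1 \<inter> \<Gamma>2 = {}"
    and "\<forall>x\<in>\<Gamma>2. unit_normal \<Omega> x (\<nu> x)"
    and "elliptic_on \<Omega> c"
    and "polyharmonic_spline \<phi>"
    and "NB \<ge> 1"
    and "P ` {..<NI} \<subseteq> \<Omega>" and "inj_on P {..<NI}"
    and "Q ` {..<NB} \<subseteq> frontier \<Omega>" and "inj_on Q {..<NB}"
    and "prob_space M"
    and "\<forall>i. (\<forall>x. 0 \<le> \<sigma> i x) \<and> integrable lborel (\<sigma> i)"
    and "\<forall>i. distributed M lborel (A i) (\<lambda>x. ennreal (\<sigma> i x))"
    and "prob_space.indep_vars M (\<lambda>_. borel) A UNIV"
  shows "AE \<omega> in M. invertible_mat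
           (kansa_matrix (interior_op c b \<rho>) (boundary_op \<Gamma>1 \<Gamma>2 \<nu>) \<phi> NI NB P Q (\<lambda>j. A j \<omega>))"
proof -
  interpret prob_space M by fact
  from \<open>polyharmonic_spline \<phi>\<close> show ?thesis
  proof (rule spline_normal_form[where 'n = 'n])
    fix g \<psi> k m \<kappa>
    assume k: "k \<ge> 3" and g: "g \<in> borel_measurable borel"
      and \<psi>: "\<psi> holomorphic_on UNIV" "\<And>l. \<psi> (of_real l) = of_real (g l)"
        "\<And>w. \<psi> (w + \<i> * pi) \<noteq> \<psi> (w - \<i> * pi)"
      and row: "\<And>c b \<rho> (P :: real ^ 'n) A. P \<noteq> A \<Longrightarrow> interior_op c b \<rho> (radial \<phi> A) P =
        spline_row g k m \<kappa> (\<lambda>i j. c i j P) (b P) (\<rho> P) (P - A)"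
    define n where "n = NI + NB"
    define X where "X h = (if h < NI then P h else Q (h - NI))" for h
    define C where "C h = (if h < NI then (\<lambda>i j. c i j (P h)) else (\<lambda>_ _. 0))" for h
    define B where "B h = (if h < NI then b (P h) else indicat_real \<Gamma>2 (X h) *\<^sub>R \<nu> (X h))" for h
    define \<gamma> where "\<gamma> h = (if h < NI then \<rho> (P h) else indicat_real \<Gamma>1 (X h))" for h
    define f where "f h a = spline_row g k m \<kappa> (C h) (B h) (\<gamma> h) (X h - a)" for h a
    have bdry: "X h \<in> frontier \<Omega>" if "NI \<le> h" "h < n" for h
      using that assms(13) by (auto simp: X_def n_def image_subset_iff)
    have inside: "X h \<in> \<Omega>" if "h < NI" for h
      using that assms(11) by (auto simp: X_def)
    \<comment> \<open>An open set is disjoint from its frontier, so no interior point coincides with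
      a boundary point and the joint list \<open>X\<close> stays injective.\<close>
    have "frontier \<Omega> \<inter> \<Omega> = {}"
      using \<open>open \<Omega>\<close> by (simp add: frontier_def interior_open) blast
    then have PQ: "X h \<noteq> X h'" if "h < NI" "NI \<le> h'" "h' < n" for h h'
      using inside[of h] bdry[of h'] that by auto
    have inj: "inj_on X {..<n}"
    proof (rule inj_onI)
      fix h h' assume h: "h \<in> {..<n}" "h' \<in> {..<n}" "X h = X h'"
      consider "h < NI" "h' < NI" | "h \<ge> NI" "h' \<ge> NI"
        using PQ[of h h'] PQ[of h' h] h by force
      then show "h = h'"
      proof cases
        case 1
        then show ?thesis using h inj_onD[OF assms(12), of h h'] by (simp add: X_def)
      next
        case 2
        then have "h - NI < NB" "h' - NI < NB" using h(1,2) by (simp_all add: n_def less_diff_conv2)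
        then have "h - NI = h' - NI"
          using 2 h(3) inj_onD[OF assms(14), of "h - NI" "h' - NI"] by (simp add: X_def)
        with 2 show ?thesis by simp
      qed
    qed
    \<comment> \<open>Interior rows use ellipticity; a boundary row has
      \<open>\<gamma> h = 1\<close> on \<open>\<Gamma>1\<close> and a unit vector \<open>B h\<close>
      on \<open>\<Gamma>2\<close>.\<close>
    have nondeg: "\<gamma> h \<noteq> 0 \<or> B h \<noteq> 0 \<or> (\<forall>\<xi> :: real ^ 'n. \<xi> \<noteq> 0 \<longrightarrow> quad_form (C h) \<xi> \<noteq> 0)" if "h < n" for h
    proof (cases "h < NI")
      case True
      then show ?thesis
        using inside[OF True] \<open>elliptic_on \<Omega> c\<close> by (auto simp: elliptic_on_def C_def X_def quad_form_def)
    next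
      case False
      then have "X h \<in> \<Gamma>1 \<or> X h \<in> \<Gamma>2"
        using bdry[of h] that assms(5) by auto
      moreover have "norm (\<nu> (X h)) = 1" if "X h \<in> \<Gamma>2"
        using that assms(7) by (auto simp: unit_normal_def)
      ultimately show ?thesis using False by (auto simp: \<gamma>_def B_def)
    qed
    have AE_A: "AE y in distr M borel (A j). R y" if "AE y in lborel. R y" for R and j
      using assms(17) that by (intro AE_distr_of_AE_lborel) auto
    have "AE \<omega> in M. Determinant.det (mat n n (\<lambda>(h, j). f h (A j \<omega>))) \<noteq> 0"
    proof (rule AE_det_nonzero[OF assms(18)])
      show "f h \<in> borel_measurable borel" for h
        unfolding f_def[abs_def] using g by measurable
      show "AE y in distr M borel (A j). (\<Sum>h<n. \<alpha> h * f h y) \<noteq> 0" if "\<exists>h<n. \<alpha> h \<noteq> 0" for j \<alpha>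
        unfolding f_def
        by (rule AE_A, rule AE_row_combination_nonzero[OF assms(1) inj nondeg k g \<psi> that])
    qed
    \<comment> \<open>The row formula is stated off the center only; almost surely no center hits a
      collocation point, so it gives every entry.\<close>
    moreover have "AE \<omega> in M. \<forall>h\<in>{..<n}. \<forall>j\<in>{..<n}. A j \<omega> \<noteq> X h"
    proof (intro AE_ball_countable[THEN iffD2] ballI)
      fix h j
      have "AE y in lborel. y \<noteq> X h"
        by (rule AE_I'[of "{X h}"]) (auto intro: countable_imp_null_set_lborel)
      then have "AE y in distr M borel (A j). y \<noteq> X h" by (rule AE_A)
      moreover have "A j \<in> M \<rightarrow>\<^sub>M borel"
        using assms(18) by (auto simp: indep_vars_def)
      ultimately show "AE \<omega> in M. A j \<omega> \<noteq> X h" by (rule AE_distrD[rotated])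
    qed auto
    ultimately show ?thesis
    proof eventually_elim
      case (elim \<omega>)
      have "kansa_matrix (interior_op c b \<rho>) (boundary_op \<Gamma>1 \<Gamma>2 \<nu>) \<phi> NI NB P Q (\<lambda>j. A j \<omega>)
          = mat n n (\<lambda>(h, j). f h (A j \<omega>))"
      proof (rule eq_matI)
        fix h j assume "h < dim_row (mat n n (\<lambda>(h, j). f h (A j \<omega>)))" "j < dim_col (mat n n (\<lambda>(h, j). f h (A j \<omega>)))"
        then have hj: "h < n" "j < n" by auto
        then have "X h \<noteq> A j \<omega>" using bspec[OF bspec[OF elim(2), of h], of j] by auto
        from row[OF this] show "kansa_matrix (interior_op c b \<rho>) (boundary_op \<Gamma>1 \<Gamma>2 \<nu>) \<phi> NI NB P Q (\<lambda>j. A j \<omega>) $$ (h, j)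
            = mat n n (\<lambda>(h, j). f h (A j \<omega>)) $$ (h, j)"
          using hj unfolding kansa_matrix_def boundary_op_eq_interior_op
          by (auto simp: f_def n_def X_def C_def B_def \<gamma>_def)
      qed (auto simp: kansa_matrix_def n_def)
      then show ?case
        using elim(1) invertible_mat_of_det_nonzero[of "mat n n (\<lambda>(h, j). f h (A j \<omega>))" n] by simp
    qed
  qed
qed

end
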